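(* Consider an instance of INTERMEDIATE SIMPLEX given by a polyhedron $P\subset\mathbb{R}^{k-1}$ with $n$ facets and a point set $S\subset P$ with $m$ vectors. Suppose there exists a solution $T$, i.e., a $(k-1)$-simplex with $S\subset T\subset P$, with vertices $\mathbf{v}_1,\ldots,\mathbf{v}_k$, and suppose that all vertices of $T$ are given except for one, i.e., $\mathbf{v}_1,\ldots,\mathbf{v}_{k-1}$ are given. Then the set of feasible positions for the last vertex, that is, the set of all $\mathbf{w}\in\mathbb{R}^{k-1}$ such that the convex hull $T'$ of $\mathbf{v}_1,\ldots,\mathbf{v}_{k-1},\mathbf{w}$ is a $(k-1)$-simplex with $S\subset T'\subset P$, is defined by a system of linear equations and inequalities ($mk$ equalities and $n+mk$ inequalities) in $\mathbf{w}$ and auxiliary real variables: $\mathbf{w}$ is feasible if and only if there exist values of the auxiliary variables for which the system holds.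
   Context: INTERMEDIATE SIMPLEX: given a polyhedron $P=\{\mathbf{x}\in\mathbb{R}^{k-1}: A\mathbf{x}\ge\mathbf{b}\}$, where $A\in\mathbb{R}^{n\times(k-1)}$ and $\mathbf{b}\in\mathbb{R}^n$ are such that $[A,\mathbf{b}]$ has rank $k$ (the $n$ facets of $P$ are the $n$ inequalities of this description), and given a set $S\subset\mathbb{R}^{k-1}$ of $m$ points that are all contained in $P$ and that are not all contained in any hyperplane (i.e., they affinely span $\mathbb{R}^{k-1}$), the question is whether there exists a $(k-1)$-simplex $T$ (convex hull of $k$ affinely independent points) such that $S\subset T\subset P$. The stated numbers of equalities and inequalities may include trivially satisfied ones (points of $S$ lying in the hull of $\mathbf{v}_1,\ldots,\mathbf{v}_{k-1}$ impose no constraint). *)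

theory Defs
  imports "HOL-Analysis.Analysis"
begin

text \<open>
  Throughout, the ambient space is \<^typ>\<open>real ^ 'd\<close> with \<open>CARD('d) = k - 1\<close>, and the
  inequalities describing the polyhedron are indexed by a finite type \<open>'n\<close> with
  \<open>CARD('n) = n\<close>.
\<close>

definition ineq_polyhedron :: "real ^ 'd ^ 'n \<Rightarrow> real ^ 'n \<Rightarrow> (real ^ 'd) set" where
  "ineq_polyhedron A b = {x. \<forall>i. (A *v x) $ i \<ge> b $ i}"

text \<open>
  The matrix \<open>[A, b]\<close>: its columns are indexed by \<^typ>\<open>'d option\<close>, the index \<^term>\<open>None\<close>
  standing for the additional column \<open>b\<close>.
\<close>

definition augmented_matrix :: "real ^ 'd ^ 'n \<Rightarrow> real ^ 'n \<Rightarrow> real ^ ('d option) ^ 'n" where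
  "augmented_matrix A b = (\<chi> i j. case j of None \<Rightarrow> b $ i | Some l \<Rightarrow> A $ i $ l)"

definition intermediate_simplex_instance ::
    "real ^ 'd ^ 'n \<Rightarrow> real ^ 'n \<Rightarrow> (real ^ 'd) set \<Rightarrow> bool" where
  "intermediate_simplex_instance A b S \<longleftrightarrow>
     rank (augmented_matrix A b) = CARD('d) + 1 \<and>
     finite S \<and> S \<subseteq> ineq_polyhedron A b \<and>
     \<not> (\<exists>a c. a \<noteq> 0 \<and> S \<subseteq> {x. a \<bullet> x = c})"

definition intermediate_simplex_solution ::
    "real ^ 'd ^ 'n \<Rightarrow> real ^ 'n \<Rightarrow> (real ^ 'd) set \<Rightarrow> (real ^ 'd) set \<Rightarrow> bool" where
  "intermediate_simplex_solution A b S T \<longleftrightarrow>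
     int CARD('d) simplex T \<and> S \<subseteq> T \<and> T \<subseteq> ineq_polyhedron A b"

text \<open>
  \<open>X\<close> is defined by a system of \<open>p\<close> linear equalities and \<open>r\<close> linear inequalities in the point
  \<open>w\<close> and finitely many auxiliary real variables \<open>y 0, \<dots>, y (q - 1)\<close>. All coefficients and
  right-hand sides are constants, independent of \<open>w\<close> and \<open>y\<close>; constraints that always hold are
  allowed and are counted.
\<close>

definition defined_by_linear_system :: "nat \<Rightarrow> nat \<Rightarrow> (real ^ 'd) set \<Rightarrow> bool" where
  "defined_by_linear_system p r X \<longleftrightarrow>
     (\<exists>(q :: nat)
        (C :: nat \<Rightarrow> real ^ 'd) (D :: nat \<Rightarrow> nat \<Rightarrow> real) (e :: nat \<Rightarrow> real)
        (F :: nat \<Rightarrow> real ^ 'd) (G :: nat \<Rightarrow> nat \<Rightarrow> real) (h :: nat \<Rightarrow> real).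
        \<forall>w. w \<in> X \<longleftrightarrow>
          (\<exists>y :: nat \<Rightarrow> real.
             (\<forall>i<p. C i \<bullet> w + (\<Sum>j<q. D i j * y j) = e i) \<and>
             (\<forall>i<r. F i \<bullet> w + (\<Sum>j<q. G i j * y j) \<ge> h i)))"

end

theory Submission
  imports Defs
begin

text \<open>
  Let \<open>V\<close> be the set of given vertices. A point \<open>s\<close> of \<open>S\<close> on the affine hull of \<open>V\<close> lies in the
  hull of \<open>V\<close> because it lies in \<open>T\<close>, so it does not restrict \<open>w\<close>. For any other \<open>s\<close>, the
  condition \<open>s = u w + \<Sum> \<lambda>\<^sub>x x\<close> is bilinear in \<open>u\<close> and \<open>w\<close>, but here \<open>u > 0\<close>, and division by \<open>u\<close>
  turns it into the linear condition \<open>w = s + \<Sum> c\<^sub>x (s - x)\<close> with \<open>c\<^sub>x \<ge> 0\<close>. Since \<open>S\<close>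
  spans the space, at least one such \<open>s\<close> exists, and its condition forces \<open>w\<close> off the affine
  hull of \<open>V\<close>, so that the hull of \<open>V\<close> and \<open>w\<close> is nondegenerate.
\<close>

section \<open>Sets defined by linear systems\<close>

lemma sum_lessThan_add:
  fixes f :: "nat \<Rightarrow> 'a::comm_monoid_add"
  shows "(\<Sum>j<a + b. f j) = (\<Sum>j<a. f j) + (\<Sum>j<b. f (a + j))"
  by (induction b) (auto simp: add.assoc)

lemma all_less_add_iff:
  "(\<forall>i<a + b. P i) \<longleftrightarrow> (\<forall>i<a. P i) \<and> (\<forall>i<b. P (a + i))" for a b :: nat
  by (metis add_less_cancel_left le_add_diff_inverse not_less trans_less_add1)

lemma defined_by_linear_systemI:
  assumes "\<And>w. w \<in> X \<longleftrightarrow>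
      (\<exists>y :: nat \<Rightarrow> real. (\<forall>i<p. C i \<bullet> w + (\<Sum>j<q. D i j * y j) = e i) \<and>
                        (\<forall>i<r. F i \<bullet> w + (\<Sum>j<q. G i j * y j) \<ge> h i))"
  shows "defined_by_linear_system p r X"
  unfolding defined_by_linear_system_def
  by (rule exI[of _ q], rule exI[of _ C], rule exI[of _ D], rule exI[of _ e],
      rule exI[of _ F], rule exI[of _ G], rule exI[of _ h]) (rule allI, rule assms)

text \<open>Rows reading \<open>0 = 0\<close> and \<open>0 \<ge> 0\<close> can be supplied in any
  number. This padding makes the counts come out exactly and covers the points of \<open>S\<close>
  that put no condition on \<open>w\<close>.\<close>

lemma defined_by_linear_system_UNIV: "defined_by_linear_system p r UNIV"
  by (rule defined_by_linear_systemI[where q = 0 and C = "\<lambda>_. 0" and e = "\<lambda>_. 0"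
        and F = "\<lambda>_. 0" and h = "\<lambda>_. 0"]) simp

lemma defined_by_linear_system_halfspace:
  "defined_by_linear_system 0 1 {w. a \<bullet> w \<ge> c}"
  by (rule defined_by_linear_systemI[where q = 0 and F = "\<lambda>_. a" and h = "\<lambda>_. c"]) simp

text \<open>Two systems are stacked with disjoint auxiliary variables, so the numbers of rows add
  up.\<close>

lemma defined_by_linear_system_Int:
  fixes X X' :: "(real ^ 'd) set"
  assumes "defined_by_linear_system p r X" and "defined_by_linear_system p' r' X'"
  shows "defined_by_linear_system (p + p') (r + r') (X \<inter> X')"
proof -
  define sys where "sys p r q C D e F G h w y \<longleftrightarrow>
      (\<forall>i<p. C i \<bullet> w + (\<Sum>j<q. D i j * y j) = e i) \<and>
      (\<forall>i<r. F i \<bullet> w + (\<Sum>j<q. G i j * y j) \<ge> h i)"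
    for p r q :: nat and C F :: "nat \<Rightarrow> real ^ 'd" and D G :: "nat \<Rightarrow> nat \<Rightarrow> real"
      and e h :: "nat \<Rightarrow> real" and w and y :: "nat \<Rightarrow> real"
  obtain q C D e F G h where X: "\<forall>w. w \<in> X \<longleftrightarrow> (\<exists>y. sys p r q C D e F G h w y)"
    using assms(1) unfolding defined_by_linear_system_def
    by (elim exE) (rule that[unfolded sys_def])
  obtain q' C' D' e' F' G' h' where
    X': "\<forall>w. w \<in> X' \<longleftrightarrow> (\<exists>y. sys p' r' q' C' D' e' F' G' h' w y)"
    using assms(2) unfolding defined_by_linear_system_def
    by (elim exE) (rule that[unfolded sys_def])
  \<comment> \<open>The block diagonal matrix with blocks \<open>M\<close> and \<open>M'\<close>:
    rows split at \<open>a\<close>, columns at \<open>q\<close>.\<close>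
  define blk :: "nat \<Rightarrow> (nat \<Rightarrow> nat \<Rightarrow> real) \<Rightarrow> (nat \<Rightarrow> nat \<Rightarrow> real) \<Rightarrow> nat \<Rightarrow> nat \<Rightarrow> real"
    where "blk a M M' i j = (if i < a then if j < q then M i j else 0
                             else if j < q then 0 else M' (i - a) (j - q))" for a M M' i j
  have blk_upper: "(\<Sum>j<q + q'. blk a M M' i j * y j) = (\<Sum>j<q. M i j * y j)" if "i < a"
    for a M M' i and y :: "nat \<Rightarrow> real"
    using that by (simp add: sum_lessThan_add blk_def)
  have blk_lower: "(\<Sum>j<q + q'. blk a M M' (a + i) j * y j) = (\<Sum>j<q'. M' i j * y (q + j))"
    for a M M' i and y :: "nat \<Rightarrow> real"
    by (simp add: sum_lessThan_add blk_def)
  have "w \<in> X \<inter> X' \<longleftrightarrow>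
      (\<exists>y. (\<forall>i<p + p'. (if i < p then C i else C' (i - p)) \<bullet> w
              + (\<Sum>j<q + q'. blk p D D' i j * y j) = (if i < p then e i else e' (i - p))) \<and>
           (\<forall>i<r + r'. (if i < r then F i else F' (i - r)) \<bullet> w
              + (\<Sum>j<q + q'. blk r G G' i j * y j) \<ge> (if i < r then h i else h' (i - r))))"
    (is "_ \<longleftrightarrow> (\<exists>y. ?Q y)") for w
  proof -
    have Q: "?Q y \<longleftrightarrow> sys p r q C D e F G h w y \<and>
        sys p' r' q' C' D' e' F' G' h' w (\<lambda>j. y (q + j))" for y
      unfolding all_less_add_iff sys_def by (auto simp: blk_upper blk_lower)
    \<comment> \<open>Since no auxiliary variable is shared, solutions of the two systems for the
      same \<open>w\<close> concatenate.\<close>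
    have join: "\<exists>y''. sys p r q C D e F G h w y'' \<and>
        sys p' r' q' C' D' e' F' G' h' w (\<lambda>j. y'' (q + j))"
      if "sys p r q C D e F G h w y" "sys p' r' q' C' D' e' F' G' h' w y'" for y y'
      using that
      by (intro exI[of _ "\<lambda>j. if j < q then y j else y' (j - q)"]) (simp add: sys_def)
    show ?thesis
      unfolding Q using X X' join by blast
  qed
  then show ?thesis by (rule defined_by_linear_systemI)
qed

lemma defined_by_linear_system_INT:
  assumes "finite I" and "\<And>i. i \<in> I \<Longrightarrow> defined_by_linear_system p r (X i)"
  shows "defined_by_linear_system (card I * p) (card I * r) (\<Inter>i\<in>I. X i)"
  using assms
proof (induction I rule: finite_induct)
  case empty
  then show ?case by (simp add: defined_by_linear_system_UNIV)
next
  case (insert i I)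
  then show ?case
    using defined_by_linear_system_Int[of p r "X i" "card I * p" "card I * r" "\<Inter>i\<in>I. X i"]
    by simp
qed

section \<open>Polyhedra and finitely generated cones as solution sets\<close>

lemma ineq_polyhedron_eq_INT: "ineq_polyhedron A b = (\<Inter>i. {w. A $ i \<bullet> w \<ge> b $ i})"
  by (auto simp: ineq_polyhedron_def matrix_vector_mult_def inner_vec_def)

lemma convex_ineq_polyhedron: "convex (ineq_polyhedron A b)"
  unfolding ineq_polyhedron_eq_INT by (intro convex_INT convex_halfspace_ge)

lemma defined_by_linear_system_polyhedron:
  fixes A :: "real ^ 'd ^ 'n"
  shows "defined_by_linear_system 0 CARD('n) (ineq_polyhedron A b)"
  unfolding ineq_polyhedron_eq_INT
  using defined_by_linear_system_INT[of "UNIV :: 'n set" 0 1 "\<lambda>i. {w. A $ i \<bullet> w \<ge> b $ i}"]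
  by (simp add: defined_by_linear_system_halfspace[simplified])

text \<open>The coefficients \<open>c x\<close> become the auxiliary variables: one equality per
  coordinate, one sign condition per generator.\<close>

lemma defined_by_linear_system_cone:
  fixes s :: "real ^ 'd" and z :: "'a \<Rightarrow> real ^ 'd"
  assumes "finite I"
  shows "defined_by_linear_system CARD('d) (card I)
           {w. \<exists>c. (\<forall>x\<in>I. c x \<ge> 0) \<and> w = s + (\<Sum>x\<in>I. c x *\<^sub>R z x)}"
proof -
  obtain f :: "nat \<Rightarrow> 'd" where f: "bij_betw f {..<CARD('d)} UNIV"
    using ex_bij_betw_nat_finite[of "UNIV :: 'd set"] by (auto simp: atLeast0LessThan)
  obtain g where g: "bij_betw g {..<card I} I"
    using ex_bij_betw_nat_finite[OF assms] by (auto simp: atLeast0LessThan)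
  have vec_eq: "x = y \<longleftrightarrow> (\<forall>i<CARD('d). x $ f i = y $ f i)" for x y :: "real ^ 'd"
  proof -
    have "x = y \<longleftrightarrow> (\<forall>l\<in>f ` {..<CARD('d)}. x $ l = y $ l)"
      using f by (simp add: bij_betw_def vec_eq_iff)
    then show ?thesis by auto
  qed
  have ex_reindex: "(\<exists>c. (\<forall>x\<in>I. c x \<ge> 0) \<and> w = s + (\<Sum>x\<in>I. c x *\<^sub>R z x)) \<longleftrightarrow>
      (\<exists>y. (\<forall>i<card I. (y i :: real) \<ge> 0) \<and> w = s + (\<Sum>j<card I. y j *\<^sub>R z (g j)))" for w
  proof
    assume "\<exists>c. (\<forall>x\<in>I. c x \<ge> 0) \<and> w = s + (\<Sum>x\<in>I. c x *\<^sub>R z x)"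
    then obtain c where "\<forall>x\<in>I. c x \<ge> 0" "w = s + (\<Sum>x\<in>I. c x *\<^sub>R z x)" by blast
    then have "(\<forall>i<card I. (c \<circ> g) i \<ge> 0) \<and> w = s + (\<Sum>j<card I. (c \<circ> g) j *\<^sub>R z (g j))"
      using bij_betwE[OF g] sum.reindex_bij_betw[OF g, of "\<lambda>x. c x *\<^sub>R z x"] by simp
    then show "\<exists>y. (\<forall>i<card I. y i \<ge> 0) \<and> w = s + (\<Sum>j<card I. y j *\<^sub>R z (g j))"
      by (rule exI[of _ "c \<circ> g"])
  next
    assume "\<exists>y. (\<forall>i<card I. (y i :: real) \<ge> 0) \<and> w = s + (\<Sum>j<card I. y j *\<^sub>R z (g j))"
    then obtain y where y: "\<forall>i<card I. (y i :: real) \<ge> 0"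
        "w = s + (\<Sum>j<card I. y j *\<^sub>R z (g j))"
      by blast
    define g' where "g' = inv_into {..<card I} g"
    have g': "g' x < card I" if "x \<in> I" for x
      using bij_betwE[OF bij_betw_inv_into[OF g]] that by (simp add: g'_def)
    have "(\<Sum>x\<in>I. y (g' x) *\<^sub>R z x) = (\<Sum>j<card I. y (g' (g j)) *\<^sub>R z (g j))"
      by (rule sum.reindex_bij_betw[OF g, symmetric])
    also have "\<dots> = (\<Sum>j<card I. y j *\<^sub>R z (g j))"
      using bij_betw_inv_into_left[OF g] by (intro sum.cong) (auto simp: g'_def)
    finally show "\<exists>c. (\<forall>x\<in>I. c x \<ge> 0) \<and> w = s + (\<Sum>x\<in>I. c x *\<^sub>R z x)"
      using y g' by (intro exI[of _ "\<lambda>x. y (g' x)"]) simp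
  qed
  have delta: "(\<Sum>j<card I. (if i = j then 1 else 0) * y j) = y i" if "i < card I"
    for i and y :: "nat \<Rightarrow> real"
    using that by (simp add: if_distrib[where f = "\<lambda>a. a * _"] cong: if_cong)
  \<comment> \<open>Row \<open>i\<close> of the equalities is coordinate \<open>f i\<close> with the
    sum moved to the left; the inequalities have the identity matrix as coefficients of
    \<open>y\<close>.\<close>
  have "w \<in> {w. \<exists>c. (\<forall>x\<in>I. c x \<ge> 0) \<and> w = s + (\<Sum>x\<in>I. c x *\<^sub>R z x)} \<longleftrightarrow>
      (\<exists>y. (\<forall>i<CARD('d). axis (f i) 1 \<bullet> w + (\<Sum>j<card I. - (z (g j) $ f i) * y j) = s $ f i) \<and>
           (\<forall>i<card I. 0 \<bullet> w + (\<Sum>j<card I. (if i = j then 1 else 0) * y j) \<ge> 0))" for w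
    unfolding mem_Collect_eq ex_reindex vec_eq[of w]
    by (intro ex_cong1)
       (simp add: delta, simp add: inner_axis' sum_negf algebra_simps conj_commute)
  then show ?thesis by (rule defined_by_linear_systemI)
qed

section \<open>Position of the last vertex\<close>

text \<open>The affine dimension of a finite set is at most its size minus one, so with at most
  \<open>d + 1\<close> points dimension \<open>d\<close> forces exactly \<open>d + 1\<close>
  affinely independent ones.\<close>

lemma simplex_convex_hull_iff:
  fixes B :: "'a::euclidean_space set"
  assumes "finite B" and "card B \<le> d + 1"
  shows "int d simplex (convex hull B) \<longleftrightarrow> aff_dim B = int d"
proof
  assume "int d simplex (convex hull B)"
  then show "aff_dim B = int d"
    using aff_dim_simplex[of "int d" "convex hull B"] by (simp add: aff_dim_convex_hull)
next
  assume dim: "aff_dim B = int d"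
  then have "int (card B) = int d + 1"
    using aff_dim_le_card[OF assms(1)] assms(2) by simp
  then show "int d simplex (convex hull B)"
    unfolding simplex_def using dim assms(1) affine_independent_iff_card[of B] by auto
qed

text \<open>If \<open>w\<close> had nonzero weight in \<open>s\<close>, solving for \<open>w\<close>
  would make it an affine combination of two points of \<open>affine hull V\<close>.\<close>

lemma mem_convex_hull_insert_affine_hull:
  assumes "s \<in> convex hull (insert w V)" and "s \<in> affine hull V" and "w \<notin> affine hull V"
    and "V \<noteq> {}"
  shows "s \<in> convex hull V"
proof -
  obtain u t x where ut: "u \<ge> 0" "t \<ge> 0" "u + t = 1" and x: "x \<in> convex hull V"
    and s: "s = u *\<^sub>R w + t *\<^sub>R x"
    using assms(1,4) by (auto simp: convex_hull_insert)
  have "u = 0"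
  proof (rule ccontr)
    assume "u \<noteq> 0"
    then have "w = (1 / u) *\<^sub>R (s - t *\<^sub>R x)" by (simp add: s)
    then have "w = (1 / u) *\<^sub>R s + (- t / u) *\<^sub>R x"
      by (simp add: scaleR_right_diff_distrib)
    moreover have "1 / u + (- t / u) = 1"
      using ut(3) \<open>u \<noteq> 0\<close> by (simp add: field_simps)
    moreover have "x \<in> affine hull V"
      using x convex_hull_subset_affine_hull by blast
    ultimately have "w \<in> affine hull V"
      using mem_affine[OF affine_affine_hull assms(2), of x "1 / u" "- t / u"] by simp
    with assms(3) show False by simp
  qed
  with s ut x show ?thesis by simp
qed

lemma apex_iff_cone:
  fixes V :: "'a::real_vector set"
  assumes "finite V" and "V \<noteq> {}" and s: "s \<notin> affine hull V"
  shows "w \<notin> affine hull V \<and> s \<in> convex hull (insert w V) \<longleftrightarrow>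
         (\<exists>c. (\<forall>x\<in>V. c x \<ge> 0) \<and> w = s + (\<Sum>x\<in>V. c x *\<^sub>R (s - x)))"
proof
  assume "w \<notin> affine hull V \<and> s \<in> convex hull (insert w V)"
  then obtain u t x where ut: "u \<ge> 0" "t \<ge> 0" "u + t = 1" and x: "x \<in> convex hull V"
    and s_eq: "s = u *\<^sub>R w + t *\<^sub>R x"
    using assms(2) by (auto simp: convex_hull_insert)
  \<comment> \<open>Otherwise \<open>s\<close> equals \<open>x\<close>, which lies in the affine
    hull of \<open>V\<close>.\<close>
  have "u \<noteq> 0"
    using s s_eq ut x convex_hull_subset_affine_hull[of V] by auto
  obtain l where l: "\<forall>x\<in>V. l x \<ge> 0" "sum l V = 1" "(\<Sum>x\<in>V. l x *\<^sub>R x) = x"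
    using x by (auto simp: convex_hull_finite[OF assms(1)])
  \<comment> \<open>The cone coefficients are the convex weights of \<open>x\<close> scaled by
    \<open>t / u\<close>; as \<open>l\<close> sums to 1, they add up to the vector from
    \<open>s\<close> to \<open>w\<close>.\<close>
  have "(\<Sum>y\<in>V. (t / u * l y) *\<^sub>R (s - y)) = (t / u) *\<^sub>R (\<Sum>y\<in>V. l y *\<^sub>R s - l y *\<^sub>R y)"
    by (simp add: scaleR_sum_right scaleR_right_diff_distrib)
  also have "\<dots> = (t / u) *\<^sub>R (s - x)"
    using l by (simp add: sum_subtractf flip: scaleR_sum_left)
  also have "\<dots> = w - s"
  proof -
    have "u *\<^sub>R ((t / u) *\<^sub>R (s - x)) = t *\<^sub>R (s - x)" using \<open>u \<noteq> 0\<close> by simp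
    also have "\<dots> = (1 - u) *\<^sub>R s - t *\<^sub>R x"
      using ut(3) by (simp add: scaleR_right_diff_distrib flip: ut(3))
    also have "\<dots> = u *\<^sub>R (w - s)"
      by (simp add: s_eq[symmetric] scaleR_left_diff_distrib scaleR_right_diff_distrib)
         (simp add: s_eq)
    finally show ?thesis using \<open>u \<noteq> 0\<close> by (metis scaleR_left_imp_eq)
  qed
  finally show "\<exists>c. (\<forall>x\<in>V. c x \<ge> 0) \<and> w = s + (\<Sum>x\<in>V. c x *\<^sub>R (s - x))"
    using ut l by (intro exI[of _ "\<lambda>y. t / u * l y"]) auto
next
  assume "\<exists>c. (\<forall>x\<in>V. c x \<ge> 0) \<and> w = s + (\<Sum>x\<in>V. c x *\<^sub>R (s - x))"
  then obtain c where c: "\<forall>x\<in>V. c x \<ge> 0" and w: "w = s + (\<Sum>x\<in>V. c x *\<^sub>R (s - x))"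
    by blast
  \<comment> \<open>The reciprocal \<open>1 / t\<close> is the weight that \<open>w\<close> receives
    in the convex combination for \<open>s\<close>.\<close>
  define t where "t = 1 + sum c V"
  have "t > 0" using c by (simp add: t_def add_pos_nonneg sum_nonneg)
  have "w = t *\<^sub>R s - (\<Sum>x\<in>V. c x *\<^sub>R x)"
    unfolding w t_def
    by (simp add: scaleR_right_diff_distrib sum_subtractf scaleR_left_distrib scaleR_sum_left)
  then have ts: "t *\<^sub>R s = w + (\<Sum>x\<in>V. c x *\<^sub>R x)" by simp
  have s_eq: "s = (1 / t) *\<^sub>R w + (\<Sum>x\<in>V. (c x / t) *\<^sub>R x)"
  proof -
    have "s = (1 / t) *\<^sub>R (t *\<^sub>R s)" using \<open>t > 0\<close> by simp
    then show ?thesis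
      unfolding ts by (simp add: scaleR_right_distrib scaleR_sum_right)
  qed
  have one: "1 / t + (\<Sum>x\<in>V. c x / t) = 1"
    using \<open>t > 0\<close> by (simp add: t_def flip: sum_divide_distrib add_divide_distrib)
  \<comment> \<open>Used twice: with \<open>W = affine hull V\<close> it shows that \<open>w\<close>
    on that hull would drag \<open>s\<close> onto it, and with the convex hull it gives the
    membership of \<open>s\<close>.\<close>
  have mem: "s \<in> W" if W: "w \<in> W" "V \<subseteq> W" "convex W" for W
  proof -
    \<comment> \<open>indexed by an option type because \<open>w\<close> could coincide with a point of \<open>V\<close>\<close>
    have "(\<Sum>i\<in>insert None (Some ` V). (case i of None \<Rightarrow> 1 / t | Some x \<Rightarrow> c x / t) *\<^sub>R
            (case i of None \<Rightarrow> w | Some x \<Rightarrow> x)) \<in> W"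
      using assms(1) W c \<open>t > 0\<close> one
      by (intro convex_sum) (auto simp: sum.reindex)
    then show ?thesis
      using assms(1) s_eq by (simp add: sum.reindex)
  qed
  show "w \<notin> affine hull V \<and> s \<in> convex hull (insert w V)"
  proof
    show "w \<notin> affine hull V"
      using mem[of "affine hull V"] s hull_subset[of V affine]
      by (auto simp: affine_imp_convex)
    show "s \<in> convex hull (insert w V)"
      using hull_subset[of "insert w V" convex] by (intro mem) auto
  qed
qed

text \<open>The feasible set is the polyhedron intersected with one set \<open>X s\<close> for each
  point \<open>s\<close> of \<open>S\<close>. The known vertex \<open>v0\<close> certifies that
  \<open>V\<close> lies in the polyhedron and that points of \<open>S\<close> on
  \<open>affine hull V\<close> lie in \<open>convex hull V\<close>.\<close>

lemma defined_by_linear_system_last_vertex: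
  fixes A :: "real ^ 'd ^ 'n" and V :: "(real ^ 'd) set"
  assumes "finite V" and "card V = CARD('d)" and dimV: "aff_dim V = int CARD('d) - 1"
    and inst: "intermediate_simplex_instance A b S"
    and sol: "intermediate_simplex_solution A b S (convex hull (insert v0 V))"
  shows "defined_by_linear_system (card S * (CARD('d) + 1)) (CARD('n) + card S * (CARD('d) + 1))
           {w. intermediate_simplex_solution A b S (convex hull (insert w V))}"
proof -
  have "V \<noteq> {}" using assms(2) by auto
  have card_insert: "card (insert w V) \<le> CARD('d) + 1" for w
    using assms(1,2) by (simp add: card_insert_if)
  \<comment> \<open>Adding \<open>w\<close> raises the dimension of \<open>V\<close> by one exactly
    when \<open>w\<close> is off its affine hull.\<close>
  have simplex_iff: "int CARD('d) simplex (convex hull (insert w V)) \<longleftrightarrow> w \<notin> affine hull V" for w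
    using simplex_convex_hull_iff[OF _ card_insert[of w]] assms(1) dimV
    by (simp add: aff_dim_insert)
  have v0: "v0 \<notin> affine hull V" and ST: "S \<subseteq> convex hull (insert v0 V)"
    and TP: "convex hull (insert v0 V) \<subseteq> ineq_polyhedron A b"
    using sol by (auto simp: intermediate_simplex_solution_def simplex_iff)
  have "V \<subseteq> ineq_polyhedron A b"
    using TP hull_subset[of "insert v0 V" convex] by blast
  then have hull_iff: "convex hull (insert w V) \<subseteq> ineq_polyhedron A b \<longleftrightarrow> w \<in> ineq_polyhedron A b"
    for w
    by (simp add: subset_hull[of convex, OF convex_ineq_polyhedron])
  \<comment> \<open>The affine hull of \<open>V\<close> lies in a hyperplane, which cannot contain
    all of \<open>S\<close>. The cone condition of \<open>s0\<close> later keeps \<open>w\<close>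
    off that hull.\<close>
  obtain s0 where s0: "s0 \<in> S" "s0 \<notin> affine hull V"
  proof -
    obtain a c where "a \<noteq> 0" "V \<subseteq> {x. a \<bullet> x = c}"
      using aff_lowdim_subset_hyperplane[of V] dimV by auto
    then have "affine hull V \<subseteq> {x. a \<bullet> x = c}"
      by (intro hull_minimal affine_hyperplane)
    with \<open>a \<noteq> 0\<close> inst show ?thesis
      unfolding intermediate_simplex_instance_def by (meson subset_iff that)
  qed
  define X where "X s = (if s \<in> affine hull V then UNIV else
      {w. \<exists>c. (\<forall>x\<in>V. c x \<ge> 0) \<and> w = s + (\<Sum>x\<in>V. c x *\<^sub>R (s - x))})" for s
  have sysX: "defined_by_linear_system (CARD('d) + 1) (CARD('d) + 1) (X s)" for s
  proof (cases "s \<in> affine hull V")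
    case True
    then show ?thesis by (simp add: X_def defined_by_linear_system_UNIV)
  next
    case False
    \<comment> \<open>only \<open>k - 1\<close> constraints of each kind are needed; the last one is trivial\<close>
    then show ?thesis
      using defined_by_linear_system_Int[OF
          defined_by_linear_system_cone[OF assms(1), of s "\<lambda>x. s - x"]
          defined_by_linear_system_UNIV[of 1 1]]
      by (simp add: X_def assms(2))
  qed
  have "{w. intermediate_simplex_solution A b S (convex hull (insert w V))}
      = ineq_polyhedron A b \<inter> (\<Inter>s\<in>S. X s)"
  proof (intro set_eqI iffI)
    fix w
    assume "w \<in> {w. intermediate_simplex_solution A b S (convex hull (insert w V))}"
    then have "w \<notin> affine hull V" "S \<subseteq> convex hull (insert w V)" "w \<in> ineq_polyhedron A b"
      by (auto simp: intermediate_simplex_solution_def simplex_iff hull_iff)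
    then show "w \<in> ineq_polyhedron A b \<inter> (\<Inter>s\<in>S. X s)"
      using apex_iff_cone[OF assms(1) \<open>V \<noteq> {}\<close>, of _ w] by (auto simp: X_def)
  next
    fix w
    assume w: "w \<in> ineq_polyhedron A b \<inter> (\<Inter>s\<in>S. X s)"
    then have cone: "w \<notin> affine hull V \<and> s \<in> convex hull (insert w V)"
      if "s \<in> S" "s \<notin> affine hull V" for s
      using apex_iff_cone[OF assms(1) \<open>V \<noteq> {}\<close>, of s w] that by (auto simp: X_def)
    have "s \<in> convex hull (insert w V)" if "s \<in> S" for s
    proof (cases "s \<in> affine hull V")
      case True
      then have "s \<in> convex hull V"
        using mem_convex_hull_insert_affine_hull[OF _ _ v0 \<open>V \<noteq> {}\<close>] ST that by blast
      then show ?thesis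
        using hull_mono[of V "insert w V" convex] by blast
    qed (use cone that in blast)
    then show "w \<in> {w. intermediate_simplex_solution A b S (convex hull (insert w V))}"
      using cone[OF s0] w
      by (auto simp: intermediate_simplex_solution_def simplex_iff hull_iff)
  qed
  moreover have "finite S"
    using inst by (simp add: intermediate_simplex_instance_def)
  ultimately show ?thesis
    using defined_by_linear_system_Int[OF defined_by_linear_system_polyhedron
        defined_by_linear_system_INT[OF _ sysX]]
    by simp
qed

theorem theorem5:
  fixes A :: "real ^ 'd ^ 'n" and b :: "real ^ 'n"
    and S T :: "(real ^ 'd) set"
    and v :: "nat \<Rightarrow> real ^ 'd"
    and k n m :: nat
  assumes "k = CARD('d) + 1" and "n = CARD('n)" and "m = card S"
    and "intermediate_simplex_instance A b S"
    and "intermediate_simplex_solution A b S T"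
    and "T = convex hull (v ` {1..k})"
  shows "defined_by_linear_system (m * k) (n + m * k)
           {w. intermediate_simplex_solution A b S (convex hull (v ` {1..k - 1} \<union> {w}))}"
proof -
  define V where "V = v ` {1..k - 1}"
  have "{1..k} = insert k {1..k - 1}" using assms(1) by auto
  then have T: "T = convex hull (insert (v k) V)" by (simp add: V_def assms(6))
  have "finite V" by (simp add: V_def)
  have card_le: "card V \<le> CARD('d)"
    using card_image_le[of "{1..k - 1}" v] assms(1) by (simp add: V_def)
  have "aff_dim (insert (v k) V) = int CARD('d)"
    using assms(5) aff_dim_simplex[of "int CARD('d)" T]
    by (simp add: intermediate_simplex_solution_def T aff_dim_convex_hull)
  \<comment> \<open>One point raises the dimension by at most one. Together with
    \<open>card V \<le> CARD('d)\<close> this leaves only equality, so the given vertices are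
    distinct and affinely independent.\<close>
  then have "aff_dim V \<ge> int CARD('d) - 1"
    by (simp add: aff_dim_insert split: if_splits)
  then have "card V = CARD('d)" "aff_dim V = int CARD('d) - 1"
    using aff_dim_le_card[OF \<open>finite V\<close>] card_le by linarith+
  then show ?thesis
    using defined_by_linear_system_last_vertex[OF \<open>finite V\<close>, of A b S "v k"] assms(1-5) T
    by (simp add: V_def)
qed

end
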